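(* Let $V\subset\mathbb{R}^n$ be a two-dimensional linear subspace, and let $F:\mathbb{R}^n\to\mathbb{R}$ be differentiable and strongly convex. Consider a sequence of distinct points $\{x_k\}_{k\ge0}\subset V$, and define $$g_k:=\nabla F(x_k),\qquad s_k:=x_{k+1}-x_k,\qquad y_k:=g_{k+1}-g_k\qquad(k\ge0).$$ Assume $g_k\in V$ for every $k\ge0$ and $$g_{k+1}^{\mathsf T}s_k=0\quad(k\ge0),\qquad g_{k+2}\in\operatorname{span}\{y_k\}\setminus\{0\}\quad(k\ge0).$$ Assume in addition that $s_0=-\beta_0g_0$ for some $\beta_0>0$. Then BFGS with $B_0=I_n$ and exact line search, applied to $F$ from $x_0$, generates exactly $\{x_k\}_{k\ge0}$. Every $B_k$ is positive definite and, with respect to the orthogonal decomposition $\mathbb{R}^n=V\oplus V^\perp$, has the block form $$B_k=B_k^V\oplus I_{V^\perp},$$ where $B_k^V$ denotes the restriction of $B_k$ to $V$.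
   Context: BFGS with exact line search (Hessian form): given an iterate $x_k$ with gradient $g_k=\nabla F(x_k)$ and a symmetric positive definite matrix $B_k$, the search direction $d_k$ is defined by $B_kd_k=-g_k$; an exact line search chooses $\alpha_k\in\arg\min_{\alpha\ge0}F(x_k+\alpha d_k)$ and sets $x_{k+1}=x_k+\alpha_kd_k$. With $s_k:=x_{k+1}-x_k$ and $y_k:=g_{k+1}-g_k$, the update is $$B_{k+1}=B_k-\frac{B_ks_ks_k^{\mathsf T}B_k}{s_k^{\mathsf T}B_ks_k}+\frac{y_ky_k^{\mathsf T}}{s_k^{\mathsf T}y_k}.$$ It is well defined and preserves positive definiteness when $s_k^{\mathsf T}y_k>0$. $I_n$ is the identity matrix and $I_{V^\perp}$ the identity on $V^\perp$. *)

theory Defs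
  imports "HOL-Analysis.Analysis"
begin

definition gradient :: "('a::euclidean_space \<Rightarrow> real) \<Rightarrow> 'a \<Rightarrow> 'a" where
  "gradient f x = (THE D. GDERIV f x :> D)"

lemma gradient_eqI:
  assumes "GDERIV f x :> D"
  shows "gradient f x = D"
  unfolding gradient_def
proof (rule the_equality)
  fix D' assume "GDERIV f x :> D'"
  with assms have "(\<lambda>h. h \<bullet> D') = (\<lambda>h. h \<bullet> D)"
    unfolding gderiv_def by (rule has_derivative_unique[rotated])
  then show "D' = D"
    by (simp add: fun_eq_iff vector_eq_ldot)
qed (fact assms)

lemma GDERIV_gradient:
  assumes "f differentiable (at x)"
  shows "GDERIV f x :> gradient f x"
proof -
  obtain f' where f': "(f has_derivative f') (at x)"
    using assms by (auto simp: differentiable_def)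
  then interpret f': bounded_linear f' by (rule has_derivative_bounded_linear)
  have "f' h = h \<bullet> adjoint f' 1" for h
    using adjoint_works[OF f'.linear_axioms, of h 1] by simp
  then have "f' = (\<lambda>h. h \<bullet> adjoint f' 1)" ..
  with f' have "GDERIV f x :> adjoint f' 1"
    unfolding gderiv_def by simp
  then show ?thesis
    by (simp add: gradient_eqI)
qed

definition strongly_convex :: "('a::real_inner \<Rightarrow> real) \<Rightarrow> bool" where
  "strongly_convex f \<longleftrightarrow> (\<exists>\<mu>>0. \<forall>x y. \<forall>t\<in>{0..1}.
     f ((1 - t) *\<^sub>R x + t *\<^sub>R y)
       \<le> (1 - t) * f x + t * f y - \<mu> / 2 * t * (1 - t) * (norm (x - y))\<^sup>2)"

text \<open>As usual for quasi-Newton matrices, positive definiteness includes symmetry.\<close>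

definition positive_definite :: "real^'n^'n \<Rightarrow> bool" where
  "positive_definite A \<longleftrightarrow> transpose A = A \<and> (\<forall>v. v \<noteq> 0 \<longrightarrow> 0 < v \<bullet> (A *v v))"

definition outer :: "real^'n \<Rightarrow> real^'n \<Rightarrow> real^'n^'n" where
  "outer u v = (\<chi> i j. u $ i * v $ j)"

text \<open>The row vector \<open>s\<^sup>T B\<close> is written \<open>s v* B\<close>.\<close>

definition bfgs_update :: "real^'n^'n \<Rightarrow> real^'n \<Rightarrow> real^'n \<Rightarrow> real^'n^'n" where
  "bfgs_update B s y =
     B - outer (B *v s) (s v* B) /\<^sub>R (s \<bullet> (B *v s)) + outer y y /\<^sub>R (s \<bullet> y)"

text \<open>One iteration of BFGS with exact line search, from \<open>(x, B)\<close> to \<open>(x', B')\<close>.\<close>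

definition bfgs_step ::
  "(real^'n \<Rightarrow> real) \<Rightarrow> real^'n \<Rightarrow> real^'n^'n \<Rightarrow> real^'n \<Rightarrow> real^'n^'n \<Rightarrow> bool" where
  "bfgs_step F x B x' B' \<longleftrightarrow>
     (\<exists>d \<alpha>. B *v d = - gradient F x \<and>
        is_arg_min (\<lambda>a. F (x + a *\<^sub>R d)) (\<lambda>a. 0 \<le> a) \<alpha> \<and>
        x' = x + \<alpha> *\<^sub>R d) \<and>
     B' = bfgs_update B (x' - x) (gradient F x' - gradient F x)"

definition bfgs_run ::
  "(real^'n \<Rightarrow> real) \<Rightarrow> real^'n \<Rightarrow> real^'n^'n
     \<Rightarrow> (nat \<Rightarrow> real^'n) \<Rightarrow> (nat \<Rightarrow> real^'n^'n) \<Rightarrow> bool" where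
  "bfgs_run F x0 B0 x B \<longleftrightarrow>
     x 0 = x0 \<and> B 0 = B0 \<and> (\<forall>k. bfgs_step F (x k) (B k) (x (Suc k)) (B (Suc k)))"

text \<open>
  The method started at \<open>(x0, B0)\<close> generates exactly the iterates \<open>x\<close> and the matrices \<open>B\<close>:
  they form a run, every update in it is well defined (the two denominators are positive, so
  that division by zero is never used), and there is no other run. The competing runs in the
  last conjunct are not required to be well defined, which only makes uniqueness stronger.
\<close>

definition bfgs_generates ::
  "(real^'n \<Rightarrow> real) \<Rightarrow> real^'n \<Rightarrow> real^'n^'n
     \<Rightarrow> (nat \<Rightarrow> real^'n) \<Rightarrow> (nat \<Rightarrow> real^'n^'n) \<Rightarrow> bool" where
  "bfgs_generates F x0 B0 x B \<longleftrightarrow>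
     bfgs_run F x0 B0 x B \<and>
     (\<forall>k. let s = x (Suc k) - x k; y = gradient F (x (Suc k)) - gradient F (x k)
          in 0 < s \<bullet> (B k *v s) \<and> 0 < s \<bullet> y) \<and>
     (\<forall>x' B'. bfgs_run F x0 B0 x' B' \<longrightarrow> x' = x \<and> B' = B)"

text \<open>
  \<open>A = T \<oplus> S\<close> with respect to the orthogonal decomposition into \<open>V\<close> and \<open>V\<^sup>\<bottom>\<close>; only the values
  of \<open>T\<close> on \<open>V\<close> and of \<open>S\<close> on \<open>V\<^sup>\<bottom>\<close> matter.
\<close>

definition is_orthogonal_direct_sum ::
  "(real^'n) set \<Rightarrow> real^'n^'n
     \<Rightarrow> (real^'n \<Rightarrow> real^'n) \<Rightarrow> (real^'n \<Rightarrow> real^'n) \<Rightarrow> bool" where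
  "is_orthogonal_direct_sum V A T S \<longleftrightarrow>
     T ` V \<subseteq> V \<and> S ` (V\<^sup>\<bottom>) \<subseteq> V\<^sup>\<bottom> \<and>
     (\<forall>v\<in>V. \<forall>w\<in>V\<^sup>\<bottom>. A *v (v + w) = T v + S w)"

end

(*
  Since B_(k+1) s_k = y_k and g_(k+2) is a nonzero multiple of y_k, exactness of the next line
  search gives s_k . B_(k+1) s_(k+1) = y_k . s_(k+1) = 0. Also s_k . g_(k+1) = 0, so in the plane V
  the vectors B_(k+1) s_(k+1) and g_(k+1) are parallel, and the signs of their inner products with
  s_(k+1) make s_(k+1) a positive multiple of the BFGS direction. By strong convexity, vanishing of
  the directional derivative characterises the unique line-search minimiser.
*)

theory Submission
  imports Defs
begin

section \<open>Strong convexity and gradients\<close>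

text \<open>Strong convexity on the segment from \<open>a\<close> to \<open>b\<close> bounds the
  difference quotients of F at \<open>a\<close>. In the limit the bound falls below
  \<open>F b - F a\<close> by the positive surplus \<open>?N\<close>, which gives
  strictness.\<close>

lemma strongly_convex_above_tangent:
  fixes F :: "'a::euclidean_space \<Rightarrow> real"
  assumes sc: "strongly_convex F" and diff: "F differentiable (at a)" and "a \<noteq> b"
  shows "F a + gradient F a \<bullet> (b - a) < F b"
proof -
  obtain \<mu> where \<mu>: "\<mu> > 0" and ineq: "\<And>x y t. t \<in> {0..1} \<Longrightarrow>
      F ((1 - t) *\<^sub>R x + t *\<^sub>R y)
        \<le> (1 - t) * F x + t * F y - \<mu> / 2 * t * (1 - t) * (norm (x - y))\<^sup>2"
    using sc unfolding strongly_convex_def by blast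
  let ?N = "\<mu> / 2 * (norm (a - b))\<^sup>2"
  \<comment> \<open>The base point is written as the value of the path at 0, so that the chain rule
    matches.\<close>
  have "(F has_derivative (\<lambda>h. h \<bullet> gradient F a)) (at (a + 0 *\<^sub>R (b - a)))"
    using GDERIV_gradient[OF diff] by (simp add: gderiv_def)
  moreover have "((\<lambda>t. a + t *\<^sub>R (b - a)) has_derivative (\<lambda>t. t *\<^sub>R (b - a))) (at 0)"
    by (auto intro!: derivative_eq_intros)
  ultimately have "((\<lambda>t. F (a + t *\<^sub>R (b - a)))
      has_derivative (\<lambda>t. (t *\<^sub>R (b - a)) \<bullet> gradient F a)) (at 0)"
    by (rule has_derivative_compose[rotated])
  then have "((\<lambda>t. F (a + t *\<^sub>R (b - a))) has_real_derivative gradient F a \<bullet> (b - a)) (at 0)"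
    by (simp add: has_field_derivative_def inner_commute mult_commute_abs)
  then have "((\<lambda>t. (F (a + t *\<^sub>R (b - a)) - F a) / t) \<longlongrightarrow> gradient F a \<bullet> (b - a)) (at 0)"
    by (simp add: DERIV_def)
  \<comment> \<open>Only a one-sided limit is usable: the convexity bound needs t in [0,1], and
    dividing it by t needs t > 0.\<close>
  then have lim: "((\<lambda>t. (F (a + t *\<^sub>R (b - a)) - F a) / t) \<longlongrightarrow> gradient F a \<bullet> (b - a)) (at_right 0)"
    by (rule filterlim_mono) (auto simp: at_le)
  have lim': "((\<lambda>t. F b - F a - (1 - t) * ?N) \<longlongrightarrow> F b - F a - (1 - 0) * ?N) (at_right 0)"
    by (intro tendsto_intros)
  have "\<forall>\<^sub>F t in at_right 0. (F (a + t *\<^sub>R (b - a)) - F a) / t \<le> F b - F a - (1 - t) * ?N"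
    unfolding eventually_at_right_field
  proof (intro exI[of _ 1] conjI allI impI)
    fix t :: real assume t: "0 < t" "t < 1"
    have "F (a + t *\<^sub>R (b - a)) \<le> (1 - t) * F a + t * F b - \<mu> / 2 * t * (1 - t) * (norm (a - b))\<^sup>2"
      using ineq[of t a b] t by (simp add: algebra_simps)
    then have "F (a + t *\<^sub>R (b - a)) - F a \<le> (F b - F a - (1 - t) * ?N) * t"
      by (simp add: algebra_simps)
    with t show "(F (a + t *\<^sub>R (b - a)) - F a) / t \<le> F b - F a - (1 - t) * ?N"
      by (simp add: pos_divide_le_eq)
  qed simp
  from tendsto_le[OF _ lim' lim this] have "gradient F a \<bullet> (b - a) \<le> F b - F a - ?N"
    by simp
  moreover have "?N > 0"
    using \<mu> \<open>a \<noteq> b\<close> by simp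
  ultimately show ?thesis
    by linarith
qed

text \<open>Adding the strict tangent inequalities at \<open>a\<close> and at \<open>b\<close>
  cancels the function values. This supplies the curvature condition of the update.\<close>

lemma strongly_convex_gradient_strict_mono:
  fixes F :: "'a::euclidean_space \<Rightarrow> real"
  assumes "strongly_convex F" "F differentiable (at a)" "F differentiable (at b)" "a \<noteq> b"
  shows "0 < (b - a) \<bullet> (gradient F b - gradient F a)"
  using strongly_convex_above_tangent[of F a b] strongly_convex_above_tangent[of F b a] assms
  by (simp add: inner_diff inner_commute algebra_simps)

section \<open>Orthogonality in a plane\<close>

text \<open>If the component \<open>r\<close> of \<open>a\<close> orthogonal to \<open>b\<close>
  were nonzero, then \<open>r\<close>, \<open>u\<close>, \<open>b\<close> would be three independent
  vectors in a plane.\<close>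

lemma orthogonal_in_plane_parallel:
  fixes a b u :: "'a::euclidean_space"
  assumes V: "subspace V" "dim V = 2" and "a \<in> V" "b \<in> V" "u \<in> V"
    and "u \<noteq> 0" "b \<noteq> 0" "u \<bullet> a = 0" "u \<bullet> b = 0"
  obtains c where "a = c *\<^sub>R b"
proof -
  define r where "r = a - (a \<bullet> b / (b \<bullet> b)) *\<^sub>R b"
  have "r \<in> V"
    unfolding r_def using assms by (intro subspace_diff subspace_scale)
  have rb: "r \<bullet> b = 0"
    using \<open>b \<noteq> 0\<close> by (simp add: r_def inner_diff_left)
  have ru: "r \<bullet> u = 0"
    using assms(8,9) by (simp add: r_def inner_diff_right inner_commute[of _ u])
  have "r = 0"
  proof (rule ccontr)
    assume "r \<noteq> 0"
    have "r \<noteq> b" "r \<noteq> u" "u \<noteq> b"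
      using rb ru \<open>r \<noteq> 0\<close> assms by auto
    then have "card {r, u, b} = 3"
      by simp
    have "pairwise orthogonal {r, u, b}"
      using rb ru assms by (auto simp: pairwise_def orthogonal_def inner_commute)
    then have "independent {r, u, b}"
      using \<open>r \<noteq> 0\<close> assms by (intro pairwise_orthogonal_independent) auto
    then have "card {r, u, b} \<le> dim V"
      using \<open>r \<in> V\<close> assms by (intro independent_card_le_dim) auto
    with \<open>card {r, u, b} = 3\<close> V show False
      by simp
  qed
  then show ?thesis
    by (intro that[of "a \<bullet> b / (b \<bullet> b)"]) (simp add: r_def)
qed

section \<open>Positive definite matrices, the BFGS update and a single step\<close>

lemma positive_definite_inner_commute:
  assumes "positive_definite B"
  shows "u \<bullet> (B *v v) = (B *v u) \<bullet> v"
  using assms by (metis dot_lmul_matrix positive_definite_def transpose_matrix_vector)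

lemma positive_definite_eqD:
  assumes "positive_definite B" "B *v u = B *v v"
  shows "u = v"
proof (rule ccontr)
  assume "u \<noteq> v"
  then have "0 < (u - v) \<bullet> (B *v (u - v))"
    using assms(1) by (simp add: positive_definite_def)
  with assms(2) show False
    by (simp add: matrix_vector_mult_diff_distrib)
qed

lemma outer_mult_vec: "outer u v *v w = (v \<bullet> w) *\<^sub>R u"
  by (simp add: outer_def vec_eq_iff matrix_vector_mult_def inner_vec_def sum_distrib_left
      sum_distrib_right mult_ac)

lemma bfgs_update_mult_vec:
  assumes "positive_definite B"
  shows "bfgs_update B s y *v w =
    B *v w - ((B *v s) \<bullet> w / (s \<bullet> (B *v s))) *\<^sub>R (B *v s) + (y \<bullet> w / (s \<bullet> y)) *\<^sub>R y"
proof -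
  have "s v* B = B *v s"
    using assms by (metis positive_definite_def transpose_matrix_vector)
  then show ?thesis
    by (simp add: bfgs_update_def matrix_vector_mult_add_rdistrib matrix_vector_mult_diff_rdistrib
        outer_mult_vec scaleR_matrix_vector_assoc[symmetric] divide_inverse mult.commute)
qed

text \<open>At \<open>s\<close> both quotients equal 1, so \<open>B *v s\<close> cancels and
  \<open>y\<close> remains.\<close>

lemma bfgs_update_secant:
  assumes "positive_definite B" "s \<noteq> 0" "s \<bullet> y > 0"
  shows "bfgs_update B s y *v s = y"
proof -
  have "s \<bullet> (B *v s) > 0"
    using assms by (simp add: positive_definite_def)
  then show ?thesis
    using assms by (simp add: bfgs_update_mult_vec inner_commute)
qed

text \<open>The new quadratic form is a sum of two nonnegative terms. The first vanishes only on
  multiples of \<open>s\<close>, where the second is positive unless the vector is zero.\<close>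

lemma positive_definite_bfgs_update:
  assumes B: "positive_definite B" and s: "s \<noteq> 0" "s \<bullet> y > 0"
  shows "positive_definite (bfgs_update B s y)"
proof -
  have sym: "transpose B = B"
    using B by (simp add: positive_definite_def)
  have sBs: "s \<bullet> (B *v s) > 0"
    using B s by (simp add: positive_definite_def)
  have "s v* B = B *v s"
    using sym by (metis transpose_matrix_vector)
  moreover have "B $ i $ j = B $ j $ i" for i j
    using arg_cong[OF sym, of "\<lambda>M. M $ j $ i"] by (simp add: transpose_def)
  ultimately have "transpose (bfgs_update B s y) = bfgs_update B s y"
    by (simp add: bfgs_update_def transpose_def outer_def vec_eq_iff mult.commute)
  moreover have "0 < v \<bullet> (bfgs_update B s y *v v)" if "v \<noteq> 0" for v
  proof -
    \<comment> \<open>This coefficient makes \<open>w\<close> orthogonal to \<open>s\<close> in the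
      inner product given by \<open>B\<close>.\<close>
    define t where "t = (B *v s) \<bullet> v / (s \<bullet> (B *v s))"
    define w where "w = v - t *\<^sub>R s"
    have split: "v \<bullet> (bfgs_update B s y *v v) = w \<bullet> (B *v w) + (y \<bullet> v)\<^sup>2 / (s \<bullet> y)"
    proof -
      have vBs: "v \<bullet> (B *v s) = t * (s \<bullet> (B *v s))"
        using sBs by (simp add: t_def inner_commute)
      then have sBv: "s \<bullet> (B *v v) = t * (s \<bullet> (B *v s))"
        using positive_definite_inner_commute[OF B, of s v] by (simp add: inner_commute)
      have "w \<bullet> (B *v w) = v \<bullet> (B *v v) - t * (v \<bullet> (B *v s))"
        by (simp add: w_def matrix_vector_mult_diff_distrib matrix_vector_mult_scaleR
            inner_diff vBs sBv)
      moreover have "v \<bullet> (bfgs_update B s y *v v) =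
          v \<bullet> (B *v v) - t * (v \<bullet> (B *v s)) + y \<bullet> v / (s \<bullet> y) * (v \<bullet> y)"
        by (simp only: bfgs_update_mult_vec[OF B] t_def inner_diff_right inner_add_right
            inner_scaleR_right)
      ultimately show ?thesis
        by (simp add: inner_commute[of v y] power2_eq_square)
    qed
    show ?thesis
    proof (cases "w = 0")
      case True
      then have v: "v = t *\<^sub>R s"
        by (simp add: w_def)
      with that have "t \<noteq> 0"
        by auto
      with v s have "y \<bullet> v \<noteq> 0"
        by (simp add: inner_commute)
      with split True s show ?thesis
        by simp
    next
      case False
      then have "0 < w \<bullet> (B *v w)"
        using B by (simp add: positive_definite_def)
      with split s show ?thesis
        by (simp add: add_pos_nonneg)
    qed
  qed
  ultimately show ?thesis
    by (simp add: positive_definite_def)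
qed

lemma bfgs_update_preserves_subspace:
  assumes "positive_definite B" "subspace V" "\<And>v. v \<in> V \<Longrightarrow> B *v v \<in> V"
    and "s \<in> V" "y \<in> V" "v \<in> V"
  shows "bfgs_update B s y *v v \<in> V"
  using assms by (simp add: bfgs_update_mult_vec subspace_add subspace_diff subspace_scale)

text \<open>Both rank-one corrections annihilate \<open>w\<close>: by symmetry the inner product of
  \<open>B *v s\<close> with \<open>w\<close> is that of \<open>s\<close> with
  \<open>B *v w = w\<close>, which is 0.\<close>

lemma bfgs_update_fixes_orthogonal:
  assumes "positive_definite B" "B *v w = w" "s \<bullet> w = 0" "y \<bullet> w = 0"
  shows "bfgs_update B s y *v w = w"
  using assms by (simp add: bfgs_update_mult_vec positive_definite_inner_commute[symmetric])

text \<open>The search direction is \<open>s /\<^sub>R c\<close> with step length \<open>c\<close>.\<close>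

lemma bfgs_step_iff:
  fixes F :: "real^'n \<Rightarrow> real"
  assumes sc: "strongly_convex F" and diff: "\<And>z. F differentiable (at z)"
    and B: "positive_definite B"
    and "c > 0" and dir: "B *v s = - (c *\<^sub>R gradient F x)"
    and exact: "gradient F (x + s) \<bullet> s = 0"
  shows "bfgs_step F x B x' B' \<longleftrightarrow>
    x' = x + s \<and> B' = bfgs_update B s (gradient F (x + s) - gradient F x)"
proof -
  let ?d = "s /\<^sub>R c"
  have d: "B *v ?d = - gradient F x"
    using dir \<open>c > 0\<close> by (simp add: matrix_vector_mult_scaleR)
  have cd: "x + c *\<^sub>R ?d = x + s"
    using \<open>c > 0\<close> by simp
  \<comment> \<open>The gradient at \<open>x + s\<close> is orthogonal to the search line, so the
    strict tangent inequality makes \<open>x + s\<close> the unique minimiser on the whole line, not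
    just on the ray.\<close>
  have less: "F (x + s) < F (x + a *\<^sub>R ?d)" if "x + a *\<^sub>R ?d \<noteq> x + s" for a
  proof -
    have "x + a *\<^sub>R ?d - (x + s) = (a / c - 1) *\<^sub>R s"
      by (simp add: algebra_simps divide_inverse)
    then have "gradient F (x + s) \<bullet> (x + a *\<^sub>R ?d - (x + s)) = 0"
      using exact by simp
    then show ?thesis
      using strongly_convex_above_tangent[OF sc diff that[symmetric]] by simp
  qed
  show ?thesis
  proof
    assume "bfgs_step F x B x' B'"
    then obtain d' \<alpha> where d': "B *v d' = - gradient F x"
      and \<alpha>: "is_arg_min (\<lambda>a. F (x + a *\<^sub>R d')) (\<lambda>a. 0 \<le> a) \<alpha>"
      and x': "x' = x + \<alpha> *\<^sub>R d'"
      and B': "B' = bfgs_update B (x' - x) (gradient F x' - gradient F x)"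
      by (auto simp: bfgs_step_def)
    \<comment> \<open>Injectivity of \<open>B\<close> leaves no choice of direction; then
      \<open>c\<close>, being admissible, competes with \<alpha>.\<close>
    have "d' = ?d"
      using positive_definite_eqD[OF B] d d' by metis
    have "\<not> F (x + c *\<^sub>R ?d) < F (x + \<alpha> *\<^sub>R ?d)"
      using \<alpha> \<open>c > 0\<close> unfolding is_arg_min_def \<open>d' = ?d\<close> by (meson less_imp_le)
    then have "x' = x + s"
      using less[of \<alpha>] unfolding x' \<open>d' = ?d\<close> cd by blast
    with B' show "x' = x + s \<and> B' = bfgs_update B s (gradient F (x + s) - gradient F x)"
      by simp
  next
    assume *: "x' = x + s \<and> B' = bfgs_update B s (gradient F (x + s) - gradient F x)"
    have "\<not> F (x + a *\<^sub>R ?d) < F (x + c *\<^sub>R ?d)" for a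
      unfolding cd using less[of a] by (metis less_asym less_irrefl)
    then have "is_arg_min (\<lambda>a. F (x + a *\<^sub>R ?d)) (\<lambda>a. 0 \<le> a) c"
      using \<open>c > 0\<close> unfolding is_arg_min_def by simp
    with d cd * show "bfgs_step F x B x' B'"
      unfolding bfgs_step_def by (metis add_diff_cancel_left')
  qed
qed

section \<open>The invariant of the matrices and uniqueness of the run\<close>

theorem lemma2p3:
  fixes V :: "(real^'n) set"
    and F :: "real^'n \<Rightarrow> real"
    and x g s y :: "nat \<Rightarrow> real^'n"
    and \<beta>\<^sub>0 :: real
  assumes "subspace V" and "dim V = 2"
    and "\<forall>z. F differentiable (at z)" and "strongly_convex F"
    and "inj x" and "\<forall>k. x k \<in> V"
    and "\<forall>k. g k = gradient F (x k)"
    and "\<forall>k. s k = x (k + 1) - x k"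
    and "\<forall>k. y k = g (k + 1) - g k"
    and "\<forall>k. g k \<in> V"
    and "\<forall>k. g (k + 1) \<bullet> s k = 0"
    and "\<forall>k. g (k + 2) \<in> span {y k} - {0}"
    and "\<beta>\<^sub>0 > 0" and "s 0 = - (\<beta>\<^sub>0 *\<^sub>R g 0)"
  shows "\<exists>B. bfgs_generates F (x 0) (mat 1) x B \<and>
           (\<forall>k. positive_definite (B k) \<and>
                is_orthogonal_direct_sum V (B k) (\<lambda>v. B k *v v) id)"
proof -
  \<comment> \<open>The matrices are built from the given \<open>s\<close> and \<open>y\<close>;
    that the method itself produces them is shown in \<open>step\<close>.\<close>
  define B where "B = rec_nat (mat 1) (\<lambda>k M. bfgs_update M (s k) (y k))"
  have B_0: "B 0 = mat 1" and B_Suc: "B (Suc k) = bfgs_update (B k) (s k) (y k)" for k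
    by (simp_all add: B_def)
  have diff: "F differentiable (at z)" for z
    using assms(3) by blast
  have xs: "x (Suc k) = x k + s k" for k
    using assms(8) by simp
  have y: "y k = gradient F (x k + s k) - gradient F (x k)" for k
    using assms(7,9) by (simp add: xs[symmetric])
  have sV: "s k \<in> V" and yV: "y k \<in> V" and gV: "g k \<in> V" for k
    using assms by (simp_all add: subspace_diff)
  have "x (Suc k) \<noteq> x k" for k
    using \<open>inj x\<close> by (simp add: inj_eq)
  then have s_nz: "s k \<noteq> 0" for k
    by (simp add: xs)
  have sy: "0 < s k \<bullet> y k" for k
    using strongly_convex_gradient_strict_mono[OF assms(4) diff diff, of "x k" "x k + s k"] s_nz[of k]
    by (simp add: y)
  have exact: "g (Suc k) \<bullet> s k = 0" for k
    using assms(11) by simp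
  \<comment> \<open>By exactness, the inner product of \<open>g k\<close> with \<open>s k\<close> is
    minus that of \<open>y k\<close> with \<open>s k\<close>.\<close>
  have gs: "g k \<bullet> s k < 0" for k
    using sy[of k] exact[of k] assms(9) by (simp add: inner_diff_right inner_commute)
  have conj: "y k \<bullet> s (Suc k) = 0" for k
  proof -
    have "g (Suc (Suc k)) \<in> span {y k}" "g (Suc (Suc k)) \<noteq> 0"
      using assms(12) by simp_all
    then obtain r where "g (Suc (Suc k)) = r *\<^sub>R y k" "r \<noteq> 0"
      by (auto simp: span_singleton)
    with exact[of "Suc k"] show ?thesis
      by simp
  qed
  \<comment> \<open>The second and third conjuncts are the block form; the last says that
    \<open>s k\<close> is a positive multiple of the BFGS direction.\<close>
  have inv: "positive_definite (B k) \<and> (\<forall>v\<in>V. B k *v v \<in> V) \<and> (\<forall>w\<in>V\<^sup>\<bottom>. B k *v w = w)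
      \<and> (\<exists>c>0. B k *v s k = - (c *\<^sub>R g k))" for k
  proof (induction k)
    case 0
    have "positive_definite (mat 1 :: real^'n^'n)"
      by (simp add: positive_definite_def)
    \<comment> \<open>For the identity matrix the multiplier is
      \<open>\<beta>\<^sub>0\<close>.\<close>
    with assms(13,14) show ?case
      by (auto simp: B_0)
  next
    case (Suc k)
    then have pd: "positive_definite (B k)" by blast
    have pd': "positive_definite (B (Suc k))"
      unfolding B_Suc by (rule positive_definite_bfgs_update[OF pd s_nz sy])
    have V: "B (Suc k) *v v \<in> V" if "v \<in> V" for v
      unfolding B_Suc using Suc that
      by (intro bfgs_update_preserves_subspace pd assms(1) sV yV) auto
    have perp: "B (Suc k) *v w = w" if "w \<in> V\<^sup>\<bottom>" for w
      unfolding B_Suc using Suc that sV yV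
      by (intro bfgs_update_fixes_orthogonal pd)
        (auto simp: orthogonal_comp_def orthogonal_def)
    have "s k \<bullet> (B (Suc k) *v s (Suc k)) = (B (Suc k) *v s k) \<bullet> s (Suc k)"
      by (rule positive_definite_inner_commute[OF pd'])
    also have "\<dots> = 0"
      unfolding B_Suc by (simp add: bfgs_update_secant[OF pd s_nz sy] conj)
    finally have "s k \<bullet> (B (Suc k) *v s (Suc k)) = 0" .
    moreover have "s k \<bullet> g (Suc k) = 0"
      using exact[of k] by (simp add: inner_commute)
    moreover have "g (Suc k) \<noteq> 0"
      using gs[of "Suc k"] by auto
    \<comment> \<open>Both vectors lie in \<open>V\<close> and are orthogonal to the nonzero vector
      \<open>s k\<close>.\<close>
    ultimately obtain c where c: "B (Suc k) *v s (Suc k) = c *\<^sub>R g (Suc k)"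
      using orthogonal_in_plane_parallel[OF assms(1,2) V[OF sV] gV sV s_nz] by blast
    have "0 < s (Suc k) \<bullet> (B (Suc k) *v s (Suc k))"
      using pd' s_nz by (simp add: positive_definite_def)
    also have "\<dots> = c * (g (Suc k) \<bullet> s (Suc k))"
      by (simp add: c inner_commute)
    finally have "c < 0"
      using gs[of "Suc k"] by (simp add: zero_less_mult_iff)
    with c have "\<exists>c>0. B (Suc k) *v s (Suc k) = - (c *\<^sub>R g (Suc k))"
      by (intro exI[of _ "- c"]) simp
    with pd' V perp show ?case
      by blast
  qed
  \<comment> \<open>The equivalence holds for arbitrary successors, so it yields both that the given
    sequence is a run and, by induction, that every run agrees with it.\<close>
  have step: "bfgs_step F (x k) (B k) x' B' \<longleftrightarrow> x' = x (Suc k) \<and> B' = B (Suc k)" for k x' B'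
  proof -
    obtain c where "c > 0" "B k *v s k = - (c *\<^sub>R gradient F (x k))"
      using inv[of k] assms(7) by auto
    moreover have "gradient F (x k + s k) \<bullet> s k = 0"
      using exact[of k] assms(7) by (simp add: xs)
    ultimately show ?thesis
      using inv[of k] by (simp add: bfgs_step_iff[OF assms(4) diff] xs B_Suc y)
  qed
  have unique: "x' = x \<and> B' = B" if "bfgs_run F (x 0) (mat 1) x' B'" for x' B'
  proof -
    have "x' k = x k \<and> B' k = B k" for k
    proof (induction k)
      case 0
      then show ?case
        using that by (simp add: bfgs_run_def B_0)
    next
      case (Suc k)
      have "bfgs_step F (x' k) (B' k) (x' (Suc k)) (B' (Suc k))"
        using that by (simp add: bfgs_run_def)
      with Suc show ?case
        by (simp add: step)
    qed
    then show ?thesis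
      by (simp add: fun_eq_iff)
  qed
  have "bfgs_run F (x 0) (mat 1) x B"
    by (simp add: bfgs_run_def B_0 step)
  moreover have "0 < s k \<bullet> (B k *v s k)" for k
    using inv[of k] s_nz by (simp add: positive_definite_def)
  ultimately have "bfgs_generates F (x 0) (mat 1) x B"
    using sy unique unfolding bfgs_generates_def Let_def xs add_diff_cancel_left' y by blast
  moreover have "is_orthogonal_direct_sum V (B k) (\<lambda>v. B k *v v) id" for k
    using inv[of k] by (auto simp: is_orthogonal_direct_sum_def matrix_vector_right_distrib)
  ultimately show ?thesis
    using inv by blast
qed

end
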